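(* Let $Y$ be a Banach space, $[a,b]$ a closed bounded interval of reals, and $f:[a,b]\to Y$ a continuous function whose right-sided Lipschitz derivative $L_+f(x)$ is finite for all $x\in(a,b)$. If there exists a constant $m<\infty$ such that $L_+f(x)\le m$ at every point $x$ of $(a,b)$, with the possible exception of a set of Lebesgue measure zero, then $f$ is Lipschitzian on the entire interval $[a,b]$ and $$\|f(x)-f(y)\|\le m|x-y|\quad\text{for all }x,y\in[a,b].$$ Conversely, if $\|f(x)-f(y)\|\le m|x-y|$ for all $x,y\in[a,b]$, then $L_+f(x)\le m$ for every $x\in(a,b)$.
   Context: For $x\in(a,b)$ the right-sided Lipschitz derivative of $f$ is $L_+f(x)=\limsup_{h>0,\,h\to0}\left\|\frac1h(f(x+h)-f(x))\right\|\in[0,\infty]$. A function is Lipschitzian on a set if there is a finite constant $m$ with $\|f(x)-f(y)\|\le m|x-y|$ for all $x,y$ in the set. *)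

theory Defs
  imports "HOL-Analysis.Analysis"
begin

(* A function on [a,b] is represented by a total function on the reals.  For x in (a,b) the
   limit superior only depends on the values of f on [a,b], because x + h lies in [a,b] for all
   sufficiently small h > 0.  The value always lies in [0, \<infinity>]. *)
definition right_lipschitz_deriv :: "(real \<Rightarrow> 'a::real_normed_vector) \<Rightarrow> real \<Rightarrow> ereal" where
  "right_lipschitz_deriv f x =
     Limsup (at_right 0) (\<lambda>h. ereal (norm ((1 / h) *\<^sub>R (f (x + h) - f x))))"

end

theory Submission
  imports Defs
begin

text \<open>
  The idea is to dominate \<open>f\<close> by a monotone function \<open>\<phi>\<close> whose right increments exceed those
  of \<open>f\<close> at every point. Off the exceptional null set \<open>N\<close> a slope \<open>m + \<epsilon>\<close> suffices. For points
  of \<open>N\<close>, choose open sets \<open>G n \<supseteq> N\<close> so small that the function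
  \<open>t \<mapsto> (\<Sum>n. n * measure lebesgue (G n \<inter> {c..t}))\<close> is bounded by \<open>\<epsilon>\<close>; at a point of \<open>N\<close> its slope
  to the right is at least \<open>n\<close> for every \<open>n\<close>, which beats the finite derivative of \<open>f\<close> there.
\<close>

text \<open>Continuous induction from the left: the bound survives passage to the supremum
  \<open>s\<close> of the points where it holds, and \<open>step\<close> at \<open>s\<close> would
  carry it further right if \<open>s < d\<close>.\<close>

lemma norm_diff_le_by_mono_majorant:
  fixes f :: "real \<Rightarrow> 'a::real_normed_vector" and \<phi> :: "real \<Rightarrow> real"
  assumes "c \<le> d" and cont: "continuous_on {c..d} f" and mono: "mono_on {c..d} \<phi>"
    and step: "\<And>x. x \<in> {c..<d} \<Longrightarrow>
      eventually (\<lambda>h. norm (f (x + h) - f x) \<le> \<phi> (x + h) - \<phi> x) (at_right 0)"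
  shows "norm (f d - f c) \<le> \<phi> d - \<phi> c"
proof -
  define S where "S = {t \<in> {c..d}. norm (f t - f c) \<le> \<phi> t - \<phi> c}"
  define s where "s = Sup S"
  have cS: "c \<in> S" using \<open>c \<le> d\<close> by (auto simp: S_def)
  have bdd: "bdd_above S" by (auto simp: S_def)
  have scd: "s \<in> {c..d}"
    unfolding s_def using cS bdd
    by (auto intro!: cSup_upper cSup_least simp: S_def)
  \<comment> \<open>\<open>\<phi>\<close> may jump, so \<open>S\<close> is not evidently closed.
    Freezing the right-hand side at \<open>\<phi> s\<close> gives a closed set, which contains
    \<open>S\<close> by monotonicity and hence contains its supremum.\<close>
  define K where "K = {t \<in> {c..d}. norm (f t - f c) \<le> \<phi> s - \<phi> c}"
  have "closed K"
    unfolding K_def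
    by (intro continuous_closed_preimage_constant continuous_on_closed_Collect_le
        continuous_intros cont closed_atLeastAtMost)
  moreover have "S \<subseteq> K"
  proof
    fix t assume t: "t \<in> S"
    then have "t \<le> s" unfolding s_def using bdd by (rule cSup_upper)
    then have "\<phi> t \<le> \<phi> s"
      using t scd mono by (auto simp: S_def mono_on_def)
    with t show "t \<in> K" by (auto simp: S_def K_def)
  qed
  ultimately have "s \<in> K"
    unfolding s_def using cS bdd closed_subset_contains_Sup by blast
  then have sS: "norm (f s - f c) \<le> \<phi> s - \<phi> c" by (simp add: K_def)
  have "s = d"
  proof (rule ccontr)
    assume "s \<noteq> d"
    with scd have "s \<in> {c..<d}" by auto
    then have "eventually (\<lambda>h. norm (f (s + h) - f s) \<le> \<phi> (s + h) - \<phi> s) (at_right 0)"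
      by (rule step)
    moreover have "eventually (\<lambda>h. h \<in> {0<..<d - s}) (at_right (0::real))"
      using \<open>s \<in> {c..<d}\<close> by (intro eventually_at_right_real) auto
    ultimately have "eventually (\<lambda>h. h \<in> {0<..<d - s} \<and>
        norm (f (s + h) - f s) \<le> \<phi> (s + h) - \<phi> s) (at_right (0::real))"
      by eventually_elim auto
    then obtain h where h: "0 < h" "h < d - s"
      "norm (f (s + h) - f s) \<le> \<phi> (s + h) - \<phi> s"
      using eventually_happens' trivial_limit_at_right_real
      by (metis (mono_tags, lifting) greaterThanLessThan_iff)
    have "norm (f (s + h) - f c) \<le> norm (f (s + h) - f s) + norm (f s - f c)"
      by (metis norm_triangle_ineq diff_add_cancel add_diff_eq)
    with h sS scd have "s + h \<in> S" by (auto simp: S_def)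
    then have "s + h \<le> s" unfolding s_def using bdd by (rule cSup_upper)
    with h show False by simp
  qed
  with sS show ?thesis by simp
qed

text \<open>A limit superior strictly below \<open>k\<close> bounds the quotients themselves for
  small \<open>h\<close>. The strictness is why the slope \<open>m + e\<close> is used later instead
  of \<open>m\<close>.\<close>

lemma eventually_norm_diff_le_of_right_lipschitz_deriv:
  assumes "right_lipschitz_deriv f x < ereal k"
  shows "eventually (\<lambda>h. norm (f (x + h) - f x) \<le> k * h) (at_right 0)"
proof -
  have "eventually (\<lambda>h. ereal (norm ((1 / h) *\<^sub>R (f (x + h) - f x))) < ereal k) (at_right 0)"
    using assms unfolding right_lipschitz_deriv_def by (rule Limsup_lessD)
  then show ?thesis
    using eventually_at_right_less[of "0::real"]
    by eventually_elim (simp add: pos_divide_less_eq less_imp_le mult.commute)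
qed

lemma right_lipschitz_deriv_nonneg: "0 \<le> right_lipschitz_deriv f x"
  unfolding right_lipschitz_deriv_def
  by (rule le_Limsup) (auto intro!: always_eventually simp: trivial_limit_at_right_real)

text \<open>Every term of the series defining \<open>\<psi>\<close> is monotone, so the term with
  index \<open>n\<close> alone already yields slope \<open>n\<close> near a point of
  \<open>N\<close>; how small \<open>h\<close> must be depends on \<open>n\<close>.\<close>

lemma null_set_slope_function:
  fixes N :: "real set" and c e :: real
  assumes N: "N \<in> null_sets lebesgue" and e: "0 < e"
  obtains \<psi> :: "real \<Rightarrow> real"
  where "mono \<psi>" "\<And>t. 0 \<le> \<psi> t" "\<And>t. \<psi> t \<le> e"
    "\<And>x n. x \<in> N \<Longrightarrow> c \<le> x \<Longrightarrow>
      eventually (\<lambda>h. real n * h \<le> \<psi> (x + h) - \<psi> x) (at_right 0)"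
proof -
  \<comment> \<open>The divisor \<open>real n + 1\<close> compensates the weight \<open>n\<close> of
    the term (and is nonzero at \<open>n = 0\<close>); the remaining geometric factors sum to
    \<open>e\<close>.\<close>
  have "\<exists>T. open T \<and> N \<subseteq> T \<and> T \<in> lmeasurable \<and>
      measure lebesgue T < e * (1/2) ^ Suc n / (real n + 1)" for n
  proof -
    define r where "r = e * (1/2) ^ Suc n / (real n + 1)"
    have "0 < r" using e by (simp add: r_def)
    then obtain T where T: "open T" "N \<subseteq> T" "T - N \<in> lmeasurable"
      "emeasure lebesgue (T - N) < ennreal r"
      using sets_lebesgue_outer_open[of N r] N by auto
    \<comment> \<open>Outer regularity controls only \<open>T - N\<close>; as \<open>N\<close> is
      null, the same bound holds for \<open>T\<close>.\<close>
    have "N \<in> lmeasurable" using N by (auto simp: fmeasurable_def null_sets_def)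
    with T have Tm: "T \<in> lmeasurable"
      by (metis fmeasurable.Un Un_Diff_cancel2 sup.absorb1)
    moreover have "measure lebesgue (T - N) < r"
      using T(3,4) by (simp add: emeasure_eq_measure2 ennreal_less_iff)
    moreover have "measure lebesgue (T - N) = measure lebesgue T"
      using N Tm by (intro measure_Diff_null_set) auto
    ultimately show ?thesis using T by (auto simp: r_def)
  qed
  then obtain G where G: "\<And>n. open (G n)" "\<And>n. N \<subseteq> G n" "\<And>n. G n \<in> lmeasurable"
    "\<And>n. measure lebesgue (G n) < e * (1/2) ^ Suc n / (real n + 1)"
    by metis
  define g where "g n t = real n * measure lebesgue (G n \<inter> {c..t})" for n t
  define \<psi> where "\<psi> t = (\<Sum>n. g n t)" for t
  have meas: "G n \<inter> {c..t} \<in> lmeasurable" for n t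
    using G(3) by (intro fmeasurable_Int_fmeasurable) auto
  have g0: "0 \<le> g n t" for n t by (simp add: g_def)
  have gmono: "g n s \<le> g n t" if "s \<le> t" for n s t
    unfolding g_def using that meas[of n]
    by (intro mult_left_mono measure_mono_fmeasurable) (auto dest: fmeasurableD)
  have gle: "g n t \<le> e * (1/2) ^ Suc n" for n t
  proof -
    have "measure lebesgue (G n \<inter> {c..t}) \<le> measure lebesgue (G n)"
      using meas[of n t] G(3)[of n] by (intro measure_mono_fmeasurable) (auto dest: fmeasurableD)
    also have "\<dots> \<le> e * (1/2) ^ Suc n / (real n + 1)" using G(4)[of n] by simp
    finally have "(real n + 1) * measure lebesgue (G n \<inter> {c..t}) \<le> e * (1/2) ^ Suc n"
      by (simp only: pos_le_divide_eq mult.commute[of "real n + 1"])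
    moreover have "g n t \<le> (real n + 1) * measure lebesgue (G n \<inter> {c..t})"
      unfolding g_def by (intro mult_right_mono) auto
    ultimately show ?thesis by linarith
  qed
  have es: "(\<lambda>n. e * (1/2) ^ Suc n) sums e"
    using sums_mult[OF power_half_series, of e] by simp
  have sumg: "summable (\<lambda>n. g n t)" for t
  proof (rule summable_comparison_test'[OF sums_summable[OF es]])
    show "norm (g n t) \<le> e * (1/2) ^ Suc n" for n
      using g0[of n t] gle[of n t] by (simp only: real_norm_def abs_of_nonneg)
  qed
  show ?thesis
  proof (rule that)
    show "mono \<psi>"
      unfolding \<psi>_def by (intro monoI suminf_le sumg gmono)
    show "0 \<le> \<psi> t" for t
      unfolding \<psi>_def by (intro suminf_nonneg sumg g0)
    show "\<psi> t \<le> e" for t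
      unfolding \<psi>_def using suminf_le[OF gle sumg sums_summable[OF es]] sums_unique[OF es]
      by simp
    show "eventually (\<lambda>h. real n * h \<le> \<psi> (x + h) - \<psi> x) (at_right 0)"
      if "x \<in> N" "c \<le> x" for x n
    proof -
      obtain r where r: "r > 0" "ball x r \<subseteq> G n"
        using G(1,2) \<open>x \<in> N\<close> by (meson openE subsetD)
      have "eventually (\<lambda>h. h \<in> {0<..<r}) (at_right (0::real))"
        using r by (intro eventually_at_right_real)
      then show ?thesis
      proof eventually_elim
        case (elim h)
        \<comment> \<open>By openness the whole step lies in \<open>G n\<close>, so
          \<open>g n\<close> grows by exactly \<open>n * h\<close>. The half-open interval keeps the
          union below disjoint.\<close>
        have sub: "{x<..x + h} \<subseteq> G n"
          using r elim by (auto simp: dist_real_def subset_iff)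
        have "G n \<inter> {c..x + h} = (G n \<inter> {c..x}) \<union> {x<..x + h}"
          using sub elim \<open>c \<le> x\<close> by auto
        moreover have "measure lebesgue ((G n \<inter> {c..x}) \<union> {x<..x + h})
            = measure lebesgue (G n \<inter> {c..x}) + measure lebesgue {x<..x + h}"
          using meas[of n x] bounded_set_imp_lmeasurable[of "{x<..x + h}"]
          by (intro measure_Un_AE always_eventually) auto
        ultimately have "real n * h = g n (x + h) - g n x"
          using elim by (simp add: g_def algebra_simps)
        \<comment> \<open>The increments of all other terms are nonnegative.\<close>
        also have "\<dots> \<le> (\<Sum>k. g k (x + h) - g k x)"
          using sum_le_suminf[OF summable_diff[OF sumg sumg], of "{n}" "x + h" x] elim
          by (simp add: gmono)
        also have "\<dots> = \<psi> (x + h) - \<psi> x"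
          unfolding \<psi>_def by (simp add: suminf_diff sumg)
        finally show ?case .
      qed
    qed
  qed
qed

lemma norm_diff_le_of_AE_right_lipschitz_deriv:
  fixes f :: "real \<Rightarrow> 'a::real_normed_vector"
  assumes "c \<le> d" and "0 \<le> m" and cont: "continuous_on {c..d} f"
    and fin: "\<And>x. x \<in> {c..<d} \<Longrightarrow> right_lipschitz_deriv f x < \<infinity>"
    and ae: "AE x in lebesgue. x \<in> {c..<d} \<longrightarrow> right_lipschitz_deriv f x \<le> ereal m"
  shows "norm (f d - f c) \<le> m * (d - c)"
proof -
  obtain N where N: "N \<in> null_sets lebesgue"
    "\<And>x. x \<in> {c..<d} - N \<Longrightarrow> right_lipschitz_deriv f x \<le> ereal m"
    using ae by (rule AE_E3) auto
  have bound: "norm (f d - f c) \<le> m * (d - c) + e * (d - c + 1)" if e: "0 < e" for e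
  proof -
    obtain \<psi> where \<psi>: "mono \<psi>" "\<And>t. 0 \<le> \<psi> t" "\<And>t. \<psi> t \<le> e"
      "\<And>x n. x \<in> N \<Longrightarrow> c \<le> x \<Longrightarrow>
        eventually (\<lambda>h. real n * h \<le> \<psi> (x + h) - \<psi> x) (at_right 0)"
      using null_set_slope_function[OF N(1) e, of c] by blast
    \<comment> \<open>The linear part pays for the points off \<open>N\<close>, and
      \<open>\<psi>\<close> for those in \<open>N\<close>.\<close>
    define \<phi> where "\<phi> t = (m + e) * t + \<psi> t" for t
    have "norm (f d - f c) \<le> \<phi> d - \<phi> c"
    proof (rule norm_diff_le_by_mono_majorant[OF \<open>c \<le> d\<close> cont])
      show "mono_on {c..d} \<phi>"
        unfolding \<phi>_def using \<psi>(1) \<open>0 \<le> m\<close> e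
        by (intro mono_onI add_mono mult_left_mono) (auto dest: monoD)
      fix x assume x: "x \<in> {c..<d}"
      have pos: "eventually (\<lambda>h::real. 0 < h) (at_right 0)"
        by (rule eventually_at_right_less)
      show "eventually (\<lambda>h. norm (f (x + h) - f x) \<le> \<phi> (x + h) - \<phi> x) (at_right 0)"
      proof (cases "x \<in> N")
        case True
        \<comment> \<open>No bound uniform in \<open>x\<close> is available; \<open>n\<close> may
          depend on \<open>x\<close> because \<open>\<psi>\<close> beats every slope at
          \<open>x\<close>.\<close>
        obtain n where n: "right_lipschitz_deriv f x < ereal (real n)"
          using fin[OF x] less_PInf_Ex_of_nat by auto
        have "eventually (\<lambda>h. real n * h \<le> \<psi> (x + h) - \<psi> x) (at_right 0)"
          using \<psi>(4) True x by auto
        then show ?thesis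
          using eventually_norm_diff_le_of_right_lipschitz_deriv[OF n] pos
        proof eventually_elim
          case (elim h)
          moreover have "0 \<le> (m + e) * h" using elim \<open>0 \<le> m\<close> e by simp
          ultimately show ?case unfolding \<phi>_def by (simp add: distrib_left)
        qed
      next
        case False
        then have "right_lipschitz_deriv f x \<le> ereal m" using N(2) x by auto
        also have "\<dots> < ereal (m + e)" using e by simp
        finally have "eventually (\<lambda>h. norm (f (x + h) - f x) \<le> (m + e) * h) (at_right 0)"
          by (rule eventually_norm_diff_le_of_right_lipschitz_deriv)
        then show ?thesis
          using pos
        proof eventually_elim
          case (elim h)
          moreover have "\<psi> x \<le> \<psi> (x + h)" using elim \<psi>(1) by (auto intro: monoD)
          ultimately show ?case unfolding \<phi>_def by (simp add: distrib_left)
        qed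
      qed
    qed
    \<comment> \<open>\<open>\<psi>\<close> takes values in \<open>{0..e}\<close>, so it costs at
      most \<open>e\<close> in total.\<close>
    also have "\<dots> \<le> (m + e) * (d - c) + e"
      unfolding \<phi>_def using \<psi>(2)[of c] \<psi>(3)[of d] by (simp add: algebra_simps)
    finally show ?thesis by (simp add: algebra_simps)
  qed
  show ?thesis
  proof (rule field_le_epsilon)
    fix \<epsilon> :: real assume "0 < \<epsilon>"
    then show "norm (f d - f c) \<le> m * (d - c) + \<epsilon>"
      using bound[of "\<epsilon> / (d - c + 1)"] \<open>c \<le> d\<close> by simp
  qed
qed

theorem corollary10p1:
  fixes f :: "real \<Rightarrow> 'a::banach" and a b m :: real
  assumes "a \<le> b"
    and "continuous_on {a..b} f"
    and "\<forall>x\<in>{a<..<b}. right_lipschitz_deriv f x < \<infinity>"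
  shows "((AE x in lebesgue. x \<in> {a<..<b} \<longrightarrow> right_lipschitz_deriv f x \<le> ereal m) \<longrightarrow>
            (\<exists>C. C-lipschitz_on {a..b} f) \<and>
            (\<forall>x\<in>{a..b}. \<forall>y\<in>{a..b}. norm (f x - f y) \<le> m * \<bar>x - y\<bar>)) \<and>
         ((\<forall>x\<in>{a..b}. \<forall>y\<in>{a..b}. norm (f x - f y) \<le> m * \<bar>x - y\<bar>) \<longrightarrow>
            (\<forall>x\<in>{a<..<b}. right_lipschitz_deriv f x \<le> ereal m))"
proof (intro conjI impI)
  assume ae: "AE x in lebesgue. x \<in> {a<..<b} \<longrightarrow> right_lipschitz_deriv f x \<le> ereal m"
  \<comment> \<open>For negative \<open>m\<close> the exceptional set would be all of
    \<open>{a<..<b}\<close>, which has positive measure. If \<open>a = b\<close>, the assumption is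
    vacuous and \<open>m\<close> may be negative.\<close>
  have m0: "0 \<le> m" if "a < b"
  proof (rule ccontr)
    assume "\<not> 0 \<le> m"
    then have "\<not> right_lipschitz_deriv f x \<le> ereal m" for x
      using right_lipschitz_deriv_nonneg[of f x] by (metis ereal_less_eq(5) order_trans)
    with ae have "AE x in lebesgue. x \<notin> {a<..<b}" by simp
    then have "{a<..<b} \<in> null_sets lebesgue"
      by (subst AE_iff_null_sets) auto
    with that show False by (simp add: null_sets_def)
  qed
  \<comment> \<open>With \<open>a < x\<close>, the interval \<open>{x..<y}\<close> lies inside
    \<open>{a<..<b}\<close>, so the derivative is controlled at its left endpoint as well.\<close>
  have inner: "norm (f y - f x) \<le> m * (y - x)" if "a < x" "x \<le> y" "y \<le> b" for x y
  proof (rule norm_diff_le_of_AE_right_lipschitz_deriv[OF \<open>x \<le> y\<close>])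
    show "0 \<le> m" using m0 that by simp
    show "continuous_on {x..y} f"
      using assms(2) by (rule continuous_on_subset) (use that in auto)
    show "right_lipschitz_deriv f z < \<infinity>" if "z \<in> {x..<y}" for z
      using assms(3) that \<open>a < x\<close> \<open>y \<le> b\<close> by auto
    show "AE z in lebesgue. z \<in> {x..<y} \<longrightarrow> right_lipschitz_deriv f z \<le> ereal m"
      using ae by eventually_elim (use that in auto)
  qed
  have ordered: "norm (f y - f x) \<le> m * (y - x)" if "a \<le> x" "x \<le> y" "y \<le> b" for x y
  proof (cases "a < x \<or> x = y")
    case True
    with that inner show ?thesis by auto
  next
    case False
    with that have x: "x = a" "a < y" by auto
    \<comment> \<open>Nothing is known about the derivative at \<open>a\<close>, so the estimate
      from \<open>t > a\<close> is carried to \<open>a\<close> by continuity.\<close>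
    have "((\<lambda>t. norm (f y - f t)) \<longlongrightarrow> norm (f y - f a)) (at_right a)"
    proof (intro tendsto_intros)
      have "(f \<longlongrightarrow> f a) (at a within {a..b})"
        using assms(1,2) by (simp add: continuous_on)
      then show "(f \<longlongrightarrow> f a) (at_right a)"
        using x that by (simp add: at_within_Icc_at_right)
    qed
    moreover have "((\<lambda>t. m * (y - t)) \<longlongrightarrow> m * (y - a)) (at_right a)"
      by (intro tendsto_intros)
    moreover have "eventually (\<lambda>t. norm (f y - f t) \<le> m * (y - t)) (at_right a)"
      using eventually_at_right_real[OF x(2)]
      by eventually_elim (use inner that in auto)
    ultimately show ?thesis
      unfolding x(1) by (intro tendsto_le[of "at_right a"]) (auto simp: trivial_limit_at_right_real)
  qed
  show main: "\<forall>x\<in>{a..b}. \<forall>y\<in>{a..b}. norm (f x - f y) \<le> m * \<bar>x - y\<bar>"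
  proof (intro ballI)
    fix x y assume xy: "x \<in> {a..b}" "y \<in> {a..b}"
    show "norm (f x - f y) \<le> m * \<bar>x - y\<bar>"
    proof (cases "x \<le> y")
      case True
      with ordered[of x y] xy show ?thesis by (simp add: norm_minus_commute)
    next
      case False
      with ordered[of y x] xy show ?thesis by simp
    qed
  qed
  \<comment> \<open>A Lipschitz constant must be nonnegative, while \<open>m\<close> can be negative
    when \<open>a = b\<close>.\<close>
  have "(max m 0)-lipschitz_on {a..b} f"
  proof (rule lipschitz_onI)
    fix x y assume "x \<in> {a..b}" "y \<in> {a..b}"
    with main have "norm (f x - f y) \<le> m * \<bar>x - y\<bar>" by blast
    also have "\<dots> \<le> max m 0 * \<bar>x - y\<bar>" by (intro mult_right_mono) auto
    finally show "dist (f x) (f y) \<le> max m 0 * dist x y"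
      by (simp add: dist_norm)
  qed simp
  then show "\<exists>C. C-lipschitz_on {a..b} f" by blast
next
  assume lip: "\<forall>x\<in>{a..b}. \<forall>y\<in>{a..b}. norm (f x - f y) \<le> m * \<bar>x - y\<bar>"
  show "\<forall>x\<in>{a<..<b}. right_lipschitz_deriv f x \<le> ereal m"
  proof
    fix x assume x: "x \<in> {a<..<b}"
    \<comment> \<open>For these \<open>h\<close> the point \<open>x + h\<close> stays in
      \<open>{a..b}\<close>, so each quotient is at most \<open>m\<close>.\<close>
    have "eventually (\<lambda>h. h \<in> {0<..<b - x}) (at_right (0::real))"
      using x by (intro eventually_at_right_real) auto
    then have "eventually (\<lambda>h. ereal (norm ((1 / h) *\<^sub>R (f (x + h) - f x))) \<le> ereal m) (at_right 0)"
    proof eventually_elim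
      case (elim h)
      with x lip have "norm (f (x + h) - f x) \<le> m * \<bar>x + h - x\<bar>"
        by (intro lip[rule_format]) auto
      with elim show ?case by (simp add: pos_divide_le_eq)
    qed
    then show "right_lipschitz_deriv f x \<le> ereal m"
      unfolding right_lipschitz_deriv_def by (rule Limsup_bounded)
  qed
qed

end
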